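(* Let $G$ be a distance-regular graph of diameter $3$ with intersection array $\{r,b_1,b_2;1,c_2,c_3\}$. If $G$ is distance magic, then $G$ is primitive and $(r-b_2-c_2)(r-c_3)=b_2c_3$.
   Context: Graphs are finite and simple. A distance-regular graph of degree $r$, diameter $d$ and intersection array $\{r,b_1,\ldots,b_{d-1};1,c_2,\ldots,c_d\}$ is a connected $r$-regular graph of diameter $d$ for which there are positive integers $b_0=r,b_1,\ldots,b_{d-1},c_1=1,c_2,\ldots,c_d$ such that for any two vertices $u,v$ at distance $i$, there are precisely $c_i$ neighbours of $u$ at distance $i-1$ from $v$ ($1\le i\le d$) and precisely $b_i$ neighbours of $u$ at distance $i+1$ from $v$ ($0\le i\le d-1$). A distance-regular graph of diameter $d$ is antipodal if being at distance $0$ or $d$ is an equivalence relation on its vertices. It is primitive if it is neither bipartite nor antipodal. A graph $G$ on $n$ vertices is distance magic if there exist a bijection $f:V(G)\to\{1,2,\ldots,n\}$ and a constant $k$ such that $\sum_{y\in N(x)}f(y)=k$ for every vertex $x$, where $N(x)$ is the set of vertices adjacent to $x$. *)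

theory Defs
  imports "Graph_Theory.Graph_Theory"
begin

text \<open>
  A finite simple graph is an instance of the locale \<^locale>\<open>graph\<close>: a finite symmetric digraph
  without loops and parallel arcs, in which each edge is a pair of opposite arcs.
\<close>

definition neighbours :: "('a, 'b) pre_digraph \<Rightarrow> 'a \<Rightarrow> 'a set" where
  "neighbours G x = {y. x \<rightarrow>\<^bsub>G\<^esub> y}"

text \<open>
  With unit weights, the cost of a walk is its number of arcs. The value is \<open>\<infinity>\<close> if there is no walk.
\<close>

definition graph_dist :: "('a, 'b) pre_digraph \<Rightarrow> 'a \<Rightarrow> 'a \<Rightarrow> ereal" where
  "graph_dist G u v = wf_digraph.\<mu> G (\<lambda>_. 1) u v"

definition graph_diameter :: "('a, 'b) pre_digraph \<Rightarrow> ereal" where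
  "graph_diameter G = (SUP (u, v) \<in> verts G \<times> verts G. graph_dist G u v)"

text \<open>
  The intersection array \<open>{b\<^sub>0, \<dots>, b\<^sub>d\<^sub>-\<^sub>1; c\<^sub>1, \<dots>, c\<^sub>d}\<close> is given by two lists of length \<open>d\<close>, so that
  \<open>b\<^sub>i = bs ! i\<close> and \<open>c\<^sub>i = cs ! (i - 1)\<close>; the degree of the graph is \<open>b\<^sub>0\<close>.
\<close>

definition distance_regular :: "('a, 'b) pre_digraph \<Rightarrow> nat list \<Rightarrow> nat list \<Rightarrow> bool" where
  "distance_regular G bs cs \<longleftrightarrow>
     graph G \<and> connected G \<and>
     bs \<noteq> [] \<and> length cs = length bs \<and>
     (\<forall>b \<in> set bs. b > 0) \<and> (\<forall>c \<in> set cs. c > 0) \<and> cs ! 0 = 1 \<and>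
     (\<forall>v \<in> verts G. card (neighbours G v) = bs ! 0) \<and>
     graph_diameter G = ereal (real (length bs)) \<and>
     (\<forall>u \<in> verts G. \<forall>v \<in> verts G. \<forall>i. graph_dist G u v = ereal (real i) \<longrightarrow>
        (1 \<le> i \<and> i \<le> length bs \<longrightarrow>
           card {w \<in> neighbours G u. graph_dist G w v = ereal (real (i - 1))} = cs ! (i - 1)) \<and>
        (i < length bs \<longrightarrow>
           card {w \<in> neighbours G u. graph_dist G w v = ereal (real (i + 1))} = bs ! i))"

definition bipartite :: "('a, 'b) pre_digraph \<Rightarrow> bool" where
  "bipartite G \<longleftrightarrow>
     (\<exists>X Y. X \<union> Y = verts G \<and> X \<inter> Y = {} \<and>
        (\<forall>u v. u \<rightarrow>\<^bsub>G\<^esub> v \<longrightarrow> (u \<in> X \<and> v \<in> Y) \<or> (u \<in> Y \<and> v \<in> X)))"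

definition antipodal :: "('a, 'b) pre_digraph \<Rightarrow> bool" where
  "antipodal G \<longleftrightarrow>
     equiv (verts G)
       {(u, v) \<in> verts G \<times> verts G. graph_dist G u v = 0 \<or> graph_dist G u v = graph_diameter G}"

definition primitive :: "('a, 'b) pre_digraph \<Rightarrow> bool" where
  "primitive G \<longleftrightarrow> \<not> bipartite G \<and> \<not> antipodal G"

definition distance_magic :: "('a, 'b) pre_digraph \<Rightarrow> bool" where
  "distance_magic G \<longleftrightarrow>
     (\<exists>(f :: 'a \<Rightarrow> nat) k. bij_betw f (verts G) {1..card (verts G)} \<and>
        (\<forall>x \<in> verts G. (\<Sum>y \<in> neighbours G x. f y) = k))"

end

theory Submission
  imports Defs
begin

text \<open>
  Subtracting its mean turns a distance magic labelling into a nonzero function \<open>g\<close> in the kernel of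
  the adjacency matrix. Summing \<open>(A g) y = 0\<close> over the sphere of radius \<open>i\<close> around a vertex \<open>v\<close> and
  double counting gives \<open>b\<^sub>i\<^sub>-\<^sub>1 S\<^sub>i\<^sub>-\<^sub>1 + a\<^sub>i S\<^sub>i + c\<^sub>i\<^sub>+\<^sub>1 S\<^sub>i\<^sub>+\<^sub>1 = 0\<close>, where \<open>a\<^sub>i = r - b\<^sub>i - c\<^sub>i\<close> and \<open>S\<^sub>j\<close>
  is the sum of \<open>g\<close> over the sphere of radius \<open>j\<close>. For \<open>S\<^sub>0 = g v \<noteq> 0\<close> and \<open>S\<^sub>1 = 0\<close> these equations
  force \<open>a\<^sub>2 a\<^sub>3 = b\<^sub>2 c\<^sub>3 > 0\<close>. Hence \<open>a\<^sub>3 > 0\<close>, that is, some edge \<open>u w\<close> has both ends at distance 3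
  from a vertex \<open>v\<close>. It closes an odd walk through \<open>v\<close>, so the graph is not bipartite, and transitivity of being
  at distance 0 or 3 would put \<open>u\<close> and \<open>w\<close> at distance 0 or 3, so the graph is not antipodal.
\<close>

section \<open>Distances as walk lengths\<close>

lemma (in wf_digraph) awalk_cost_1: "awalk_cost (\<lambda>_. 1) p = real (length p)"
  by (induction p) auto

lemma (in wf_digraph) neighbours_subset_verts: "neighbours G u \<subseteq> verts G"
  by (auto simp: neighbours_def)

lemma (in sym_digraph) neighbours_sym: "v \<in> neighbours G u \<longleftrightarrow> u \<in> neighbours G v"
  using arcs_ends_symmetric[OF sym_arcs] by (auto simp: neighbours_def)

lemma (in loopfree_digraph) not_in_neighbours_self: "u \<notin> neighbours G u"
  using no_loops by (auto simp: neighbours_def arcs_ends_conv)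

lemma (in wf_digraph) graph_dist_le_length:
  assumes "awalk u p v"
  shows "graph_dist G u v \<le> ereal (real (length p))"
  using min_cost_le_walk_cost[OF assms, of "\<lambda>_. 1"] by (simp add: graph_dist_def awalk_cost_1)

text \<open>Every arc switches the side of the bipartition, so the parity of a walk's length records
  whether its ends lie on the same side.\<close>

lemma (in wf_digraph) even_length_awalk_bipartition:
  assumes "awalk u p v"
    and "X \<inter> Y = {}" "\<And>u v. u \<rightarrow>\<^bsub>G\<^esub> v \<Longrightarrow> (u \<in> X \<and> v \<in> Y) \<or> (u \<in> Y \<and> v \<in> X)"
  shows "even (length p) \<longleftrightarrow> (u \<in> X \<longleftrightarrow> v \<in> X)"
  using assms(1)
proof (induction p arbitrary: u)
  case Nil
  then show ?case by (simp add: awalk_Nil_iff)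
next
  case (Cons e p)
  then have "awalk (head G e) p v" "u = tail G e" "e \<in> arcs G"
    by (auto simp: awalk_Cons_iff)
  with Cons.IH[of "head G e"] assms(2) assms(3)[of u "head G e"] show ?case
    by (auto simp: arcs_ends_conv)
qed

text \<open>A natural-number copy of \<open>graph_dist\<close>, convenient for arithmetic. An
  infinite distance would be sent to 0, so it is faithful only where distances are finite, as
  between vertices of a \<open>connected_graph\<close>.\<close>

definition hop_dist :: "('a, 'b) pre_digraph \<Rightarrow> 'a \<Rightarrow> 'a \<Rightarrow> nat" where
  "hop_dist G u v = nat \<lfloor>real_of_ereal (graph_dist G u v)\<rfloor>"

locale connected_graph = graph +
  assumes connected: "connected G"
begin

lemma shortest_awalk:
  assumes "u \<in> verts G" "v \<in> verts G"
  obtains p where "awalk u p v" "length p = hop_dist G u v"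
    "graph_dist G u v = ereal (real (hop_dist G u v))"
proof -
  have "u \<rightarrow>\<^sup>* v"
    using symmetric_connected_imp_strongly_connected[OF sym_arcs connected] assms by auto
  from min_cost_awalk[OF this, of "\<lambda>_. 1"] obtain p
    where "apath u p v" "graph_dist G u v = ereal (real (length p))"
    by (auto simp: graph_dist_def awalk_cost_1)
  then show ?thesis
    using that[of p] awalkI_apath[of u p v] by (simp add: hop_dist_def)
qed

lemma graph_dist_eq_hop_dist:
  assumes "u \<in> verts G" "v \<in> verts G"
  shows "graph_dist G u v = ereal (real (hop_dist G u v))"
  using shortest_awalk[OF assms] by metis

lemma hop_dist_le_length:
  assumes "awalk u p v"
  shows "hop_dist G u v \<le> length p"
  using graph_dist_le_length[OF assms] graph_dist_eq_hop_dist[of u v] assms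
  by (simp add: awalk_hd_in_verts awalk_last_in_verts)

lemma hop_dist_eq_0_iff:
  assumes "u \<in> verts G" "v \<in> verts G"
  shows "hop_dist G u v = 0 \<longleftrightarrow> u = v"
proof
  assume "hop_dist G u v = 0"
  then show "u = v" using shortest_awalk[OF assms] by (metis awalk_Nil_iff length_0_conv)
next
  assume "u = v"
  then show "hop_dist G u v = 0" using hop_dist_le_length[of u "[]" v] assms by (simp add: awalk_Nil_iff)
qed

lemma hop_dist_neighbour_le:
  assumes "w \<in> neighbours G u" "v \<in> verts G"
  shows "hop_dist G u v \<le> Suc (hop_dist G w v)"
proof -
  from assms obtain e where e: "e \<in> arcs G" "tail G e = u" "head G e = w"
    by (auto simp: neighbours_def)
  then have "w \<in> verts G" by auto
  from shortest_awalk[OF this assms(2)] obtain p where "awalk w p v" "length p = hop_dist G w v"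
    by metis
  with e hop_dist_le_length[of u "e # p" v] show ?thesis by (auto simp: awalk_Cons_iff)
qed

lemma hop_dist_eq_1_iff:
  assumes "u \<in> verts G" "v \<in> verts G"
  shows "hop_dist G u v = 1 \<longleftrightarrow> u \<in> neighbours G v"
proof
  assume "hop_dist G u v = 1"
  with shortest_awalk[OF assms] obtain p where p: "awalk u p v" "length p = 1" by metis
  then obtain e where "p = [e]" by (auto simp: length_Suc_conv)
  with p have "v \<in> neighbours G u" by (auto simp: awalk_simps neighbours_def arcs_ends_conv)
  then show "u \<in> neighbours G v" by (simp add: neighbours_sym)
next
  assume u: "u \<in> neighbours G v"
  then have "u \<noteq> v" using not_in_neighbours_self by auto
  then have "hop_dist G u v \<noteq> 0" "hop_dist G v v = 0" using assms hop_dist_eq_0_iff by auto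
  then show "hop_dist G u v = 1"
    using hop_dist_neighbour_le[of v u v] u assms by (simp add: neighbours_sym)
qed

lemma hop_dist_neighbour_cases:
  assumes "w \<in> neighbours G u" "v \<in> verts G"
  shows "Suc (hop_dist G w v) = hop_dist G u v \<or> hop_dist G w v = hop_dist G u v \<or>
    hop_dist G w v = Suc (hop_dist G u v)"
  using hop_dist_neighbour_le[of w u v] hop_dist_neighbour_le[of u w v] assms neighbours_sym by force

lemma hop_dist_diameter:
  assumes "graph_diameter G = ereal (real d)"
  shows "\<And>u v. u \<in> verts G \<Longrightarrow> v \<in> verts G \<Longrightarrow> hop_dist G u v \<le> d"
    and "\<exists>u \<in> verts G. \<exists>v \<in> verts G. hop_dist G u v = d"
proof -
  let ?D = "(\<lambda>(u, v). graph_dist G u v) ` (verts G \<times> verts G)"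
  have Sup: "Sup ?D = ereal (real d)"
    using assms by (simp add: graph_diameter_def)
  have "graph_dist G u v \<le> ereal (real d)" if "u \<in> verts G" "v \<in> verts G" for u v
    unfolding Sup[symmetric] using that by (intro Sup_upper) auto
  then show "\<And>u v. u \<in> verts G \<Longrightarrow> v \<in> verts G \<Longrightarrow> hop_dist G u v \<le> d"
    by (simp add: graph_dist_eq_hop_dist)
  \<comment> \<open>The supremum of a finite nonempty set is its maximum, so the diameter is
    attained.\<close>
  have "?D \<noteq> {}" using connected by (auto simp: connected_conv)
  moreover have "finite ?D" by simp
  ultimately have "Sup ?D \<in> ?D" using Max_in Max_Sup by metis
  then show "\<exists>u \<in> verts G. \<exists>v \<in> verts G. hop_dist G u v = d"
    unfolding Sup by (force simp: graph_dist_eq_hop_dist)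
qed

section \<open>Spheres around a vertex\<close>

text \<open>The centre \<open>v\<close> comes first. For \<open>u\<close> at distance
  \<open>j\<close> from \<open>v\<close>, the sizes at \<open>i = j - 1\<close>, \<open>j\<close>,
  \<open>j + 1\<close> are the intersection numbers \<open>c_j\<close>, \<open>a_j\<close>,
  \<open>b_j\<close>.\<close>

definition nbrs_at :: "'a \<Rightarrow> 'a \<Rightarrow> nat \<Rightarrow> 'a set" where
  "nbrs_at v u i = {w \<in> neighbours G u. hop_dist G w v = i}"

lemma finite_neighbours [simp]: "finite (neighbours G u)"
  using neighbours_subset_verts finite_verts by (rule finite_subset)

lemma nbrs_at_graph_dist:
  assumes "v \<in> verts G"
  shows "{w \<in> neighbours G u. graph_dist G w v = ereal (real i)} = nbrs_at v u i"
  using assms neighbours_subset_verts by (auto simp: nbrs_at_def graph_dist_eq_hop_dist subset_iff)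

lemma nbrs_at_empty:
  assumes "v \<in> verts G" "Suc i < hop_dist G u v \<or> Suc (hop_dist G u v) < i"
  shows "nbrs_at v u i = {}"
  using hop_dist_neighbour_cases[of _ u v] assms by (fastforce simp: nbrs_at_def)

lemma card_neighbours_split:
  assumes "v \<in> verts G" "hop_dist G u v = Suc i"
  shows "card (neighbours G u) =
    card (nbrs_at v u i) + card (nbrs_at v u (Suc i)) + card (nbrs_at v u (Suc (Suc i)))"
proof -
  have "neighbours G u = nbrs_at v u i \<union> nbrs_at v u (Suc i) \<union> nbrs_at v u (Suc (Suc i))"
    using hop_dist_neighbour_cases[of _ u v] assms by (fastforce simp: nbrs_at_def)
  also have "card \<dots> = card (nbrs_at v u i \<union> nbrs_at v u (Suc i)) + card (nbrs_at v u (Suc (Suc i)))"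
    by (rule card_Un_disjoint) (auto simp: nbrs_at_def)
  also have "card (nbrs_at v u i \<union> nbrs_at v u (Suc i)) =
      card (nbrs_at v u i) + card (nbrs_at v u (Suc i))"
    by (rule card_Un_disjoint) (auto simp: nbrs_at_def)
  finally show ?thesis .
qed

definition sphere_sum :: "('a \<Rightarrow> real) \<Rightarrow> 'a \<Rightarrow> nat \<Rightarrow> real" where
  "sphere_sum g v i = (\<Sum>w | w \<in> verts G \<and> hop_dist G w v = i. g w)"

lemma sphere_sum_0:
  assumes "v \<in> verts G"
  shows "sphere_sum g v 0 = g v"
proof -
  have "{w. w \<in> verts G \<and> hop_dist G w v = 0} = {v}"
    using assms hop_dist_eq_0_iff by auto
  then show ?thesis by (simp add: sphere_sum_def)
qed

lemma sphere_sum_1: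
  assumes "v \<in> verts G"
  shows "sphere_sum g v 1 = (\<Sum>w \<in> neighbours G v. g w)"
proof -
  have "{w. w \<in> verts G \<and> hop_dist G w v = 1} = neighbours G v"
    using assms hop_dist_eq_1_iff neighbours_subset_verts by auto
  then show ?thesis by (simp add: sphere_sum_def)
qed

section \<open>Double counting and kernel functions of the adjacency matrix\<close>

text \<open>Double counting of the adjacent pairs \<open>(y, w)\<close> with \<open>y\<close> in
  \<open>A\<close>; symmetry of adjacency turns the inner index set into
  \<open>neighbours G w \<inter> A\<close>.\<close>

lemma sum_neighbours_swap:
  fixes g :: "'a \<Rightarrow> real"
  assumes "A \<subseteq> verts G"
  shows "(\<Sum>y \<in> A. \<Sum>w \<in> neighbours G y. g w) =
    (\<Sum>w \<in> verts G. real (card (neighbours G w \<inter> A)) * g w)"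
proof -
  have fin: "finite A" using assms finite_verts by (rule finite_subset)
  have "(\<Sum>y \<in> A. \<Sum>w \<in> neighbours G y. g w) =
      (\<Sum>y \<in> A. \<Sum>w | w \<in> verts G \<and> w \<in> neighbours G y. g w)"
    using neighbours_subset_verts by (intro sum.cong) auto
  also have "\<dots> = (\<Sum>w \<in> verts G. \<Sum>y | y \<in> A \<and> w \<in> neighbours G y. g w)"
    using fin by (intro sum.swap_restrict) auto
  also have "\<dots> = (\<Sum>w \<in> verts G. \<Sum>y \<in> neighbours G w \<inter> A. g w)"
    using neighbours_sym by (intro sum.cong refl) auto
  finally show ?thesis by simp
qed

text \<open>The kernel equations are added up over the sphere of radius \<open>i\<close> around
  \<open>v\<close>. By double counting, \<open>w\<close> contributes \<open>g w\<close> once for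
  each of its neighbours on that sphere, and this multiplicity \<open>n\<close> depends only on the
  distance of \<open>w\<close> from \<open>v\<close>. Keeping \<open>n\<close> abstract lets one
  lemma serve all radii.\<close>

lemma sphere_sum_recurrence:
  assumes kernel: "\<And>x. x \<in> verts G \<Longrightarrow> (\<Sum>y \<in> neighbours G x. g y) = 0"
    and bound: "\<And>w. w \<in> verts G \<Longrightarrow> hop_dist G w v \<le> d"
    and count: "\<And>w. w \<in> verts G \<Longrightarrow> card (nbrs_at v w i) = n (hop_dist G w v)"
  shows "(\<Sum>j\<le>d. real (n j) * sphere_sum g v j) = 0"
proof -
  let ?S = "{y \<in> verts G. hop_dist G y v = i}"
  have nbrs: "neighbours G w \<inter> ?S = nbrs_at v w i" for w
    using neighbours_subset_verts by (auto simp: nbrs_at_def)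
  have "0 = (\<Sum>y \<in> ?S. \<Sum>w \<in> neighbours G y. g w)"
    by (simp add: kernel)
  also have "\<dots> = (\<Sum>w \<in> verts G. real (n (hop_dist G w v)) * g w)"
    by (simp add: sum_neighbours_swap nbrs count)
  also have "\<dots> = (\<Sum>j\<le>d. \<Sum>w | w \<in> verts G \<and> hop_dist G w v = j. real (n (hop_dist G w v)) * g w)"
    using bound by (intro sum.group[symmetric]) auto
  also have "\<dots> = (\<Sum>j\<le>d. real (n j) * sphere_sum g v j)"
    by (simp add: sphere_sum_def sum_distrib_left)
  finally show ?thesis by simp
qed

lemma distance_magic_kernel:
  assumes "distance_magic G" and regular: "\<And>v. v \<in> verts G \<Longrightarrow> card (neighbours G v) = r"
    and "u \<in> verts G" "v \<in> verts G" "u \<noteq> v"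
  obtains g :: "'a \<Rightarrow> real" and x where "x \<in> verts G" "g x \<noteq> 0"
    "\<And>x. x \<in> verts G \<Longrightarrow> (\<Sum>y \<in> neighbours G x. g y) = 0"
proof -
  from assms(1) obtain f :: "'a \<Rightarrow> nat" and k
    where f: "bij_betw f (verts G) {1..card (verts G)}"
      and k: "\<And>x. x \<in> verts G \<Longrightarrow> (\<Sum>y \<in> neighbours G x. f y) = k"
    unfolding distance_magic_def by blast
  define m where "m = (\<Sum>x \<in> verts G. real (f x)) / card (verts G)"
  define g where "g x = real (f x) - m" for x
  have ne: "verts G \<noteq> {}" using assms(3) by auto
  have k': "(\<Sum>y \<in> neighbours G x. real (f y)) = k" if "x \<in> verts G" for x
    using k[OF that] by (metis of_nat_sum)
  \<comment> \<open>Double counting over all vertices identifies the magic constant as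
    \<open>r\<close> times the mean label \<open>m\<close>, so subtracting \<open>m\<close> from
    each label cancels \<open>k\<close>.\<close>
  have "real (card (verts G)) * k = (\<Sum>x \<in> verts G. \<Sum>y \<in> neighbours G x. real (f y))"
    by (simp add: k')
  also have "\<dots> = r * (\<Sum>x \<in> verts G. real (f x))"
    by (simp add: sum_neighbours_swap regular sum_distrib_left Int_absorb2 neighbours_subset_verts)
  finally have "real k = r * m" using ne by (simp add: m_def field_simps)
  then have "(\<Sum>y \<in> neighbours G x. g y) = 0" if "x \<in> verts G" for x
    using that by (simp add: g_def sum_subtractf k' regular)
  \<comment> \<open>Distinct labels cannot both equal the mean, so \<open>g\<close> is nonzero at
    \<open>u\<close> or at \<open>v\<close>.\<close>
  moreover have "f u \<noteq> f v" using f assms(3-5) by (auto simp: bij_betw_def inj_on_def)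
  then have "g u \<noteq> 0 \<or> g v \<noteq> 0" by (auto simp: g_def)
  ultimately show ?thesis using that assms(3,4) by metis
qed

section \<open>Imprimitivity and edges inside the outermost sphere\<close>

lemma not_primitiveD:
  assumes "\<not> primitive G" "graph_diameter G = ereal (real d)" "d \<ge> 2"
    and "u \<in> verts G" "v \<in> verts G" "hop_dist G u v = d"
  shows "nbrs_at v u d = {}"
proof (rule ccontr)
  assume "nbrs_at v u d \<noteq> {}"
  then obtain w where w: "w \<in> neighbours G u" "hop_dist G w v = d" by (auto simp: nbrs_at_def)
  then have "w \<in> verts G" using neighbours_subset_verts by auto
  from assms(1) consider "bipartite G" | "antipodal G" by (auto simp: primitive_def)
  then show False
  proof cases
    case 1
    then obtain X Y where XY: "X \<inter> Y = {}"
      "\<And>u v. u \<rightarrow>\<^bsub>G\<^esub> v \<Longrightarrow> (u \<in> X \<and> v \<in> Y) \<or> (u \<in> Y \<and> v \<in> X)"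
      unfolding bipartite_def by blast
    \<comment> \<open>All vertices at distance \<open>d\<close> from \<open>v\<close> lie on one
      side, which the edge from \<open>u\<close> to \<open>w\<close> contradicts.\<close>
    have "even d \<longleftrightarrow> (x \<in> X \<longleftrightarrow> v \<in> X)" if "x \<in> verts G" "hop_dist G x v = d" for x
      using shortest_awalk[OF that(1) \<open>v \<in> verts G\<close>] that(2)
        even_length_awalk_bipartition[OF _ XY, of x _ v] by metis
    then have "u \<in> X \<longleftrightarrow> w \<in> X" using assms \<open>w \<in> verts G\<close> w by blast
    moreover have "u \<rightarrow>\<^bsub>G\<^esub> w" using w by (simp add: neighbours_def)
    ultimately show False using XY by blast
  next
    case 2
    let ?R = "{(u, v) \<in> verts G \<times> verts G. graph_dist G u v = 0 \<or> graph_dist G u v = graph_diameter G}"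
    have R: "(x, y) \<in> ?R \<longleftrightarrow> x \<in> verts G \<and> y \<in> verts G \<and> (hop_dist G x y = 0 \<or> hop_dist G x y = d)" for x y
      by (auto simp: graph_dist_eq_hop_dist assms(2))
    have "sym ?R" "trans ?R" using 2 by (auto simp: antipodal_def equiv_def)
    moreover have "(w, v) \<in> ?R" "(u, v) \<in> ?R" unfolding R using assms w \<open>w \<in> verts G\<close> by auto
    \<comment> \<open>This forces \<open>w\<close> and \<open>u\<close> to be at distance 0 or
      \<open>d\<close>, whereas adjacent vertices are at distance 1 and
      \<open>d \<ge> 2\<close>.\<close>
    ultimately have "(w, u) \<in> ?R" by (meson symD transD)
    moreover have "hop_dist G w u = 1" using w \<open>w \<in> verts G\<close> assms(4) hop_dist_eq_1_iff by blast
    ultimately show False unfolding R using assms(3) by simp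
  qed
qed

end

section \<open>Intersection numbers and sphere sums in diameter 3\<close>

theorem theorem11:
  fixes G :: "('a, 'b) pre_digraph" and r b1 b2 c2 c3 :: nat
  assumes "distance_regular G [r, b1, b2] [1, c2, c3]"
    and "distance_magic G"
  shows "primitive G \<and>
    (int r - int b2 - int c2) * (int r - int c3) = int b2 * int c3"
proof -
  have "graph G" "connected G" and pos: "r > 0" "b2 > 0" "c2 > 0" "c3 > 0"
    and regular: "\<And>v. v \<in> verts G \<Longrightarrow> card (neighbours G v) = r"
    and diam: "graph_diameter G = ereal (real 3)"
    using assms(1) by (auto simp: distance_regular_def)
  then interpret connected_graph G by (simp add: connected_graph_def connected_graph_axioms_def)
  have "(1 \<le> i \<and> i \<le> 3 \<longrightarrow> card (nbrs_at v u (i - 1)) = [1, c2, c3] ! (i - 1)) \<and>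
      (i < 3 \<longrightarrow> card (nbrs_at v u (i + 1)) = [r, b1, b2] ! i)"
    if "u \<in> verts G" "v \<in> verts G" "hop_dist G u v = i" for u v i
  proof -
    have "graph_dist G u v = ereal (real i)"
      using that graph_dist_eq_hop_dist by simp
    with assms(1) that(1,2) have
      "(1 \<le> i \<and> i \<le> length [r, b1, b2] \<longrightarrow>
          card {w \<in> neighbours G u. graph_dist G w v = ereal (real (i - 1))} = [1, c2, c3] ! (i - 1)) \<and>
        (i < length [r, b1, b2] \<longrightarrow>
          card {w \<in> neighbours G u. graph_dist G w v = ereal (real (i + 1))} = [r, b1, b2] ! i)"
      unfolding distance_regular_def by blast
    then show ?thesis
      unfolding nbrs_at_graph_dist[OF that(2)] by (simp add: numeral_3_eq_3)
  qed
  note counts = this[of _ _ 0] this[of _ _ 1] this[of _ _ 2] this[of _ _ 3]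
  have card_0: "card (nbrs_at v u 1) = r"
    if "u \<in> verts G" "v \<in> verts G" "hop_dist G u v = 0" for u v
    using counts(1)[OF that] by simp
  have card_1: "card (nbrs_at v u 2) = b1"
    if "u \<in> verts G" "v \<in> verts G" "hop_dist G u v = 1" for u v
    using counts(2)[OF that] by (simp add: numeral_2_eq_2)
  have card_2: "card (nbrs_at v u 1) = c2" "card (nbrs_at v u 3) = b2"
    if "u \<in> verts G" "v \<in> verts G" "hop_dist G u v = 2" for u v
    using counts(3)[OF that] by (simp_all add: numeral_2_eq_2 numeral_3_eq_3)
  have card_3: "card (nbrs_at v u 2) = c3"
    if "u \<in> verts G" "v \<in> verts G" "hop_dist G u v = 3" for u v
    using counts(4)[OF that] by (simp add: numeral_2_eq_2)
  note dist_le = hop_dist_diameter(1)[OF diam]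

  \<comment> \<open>These are natural-number differences; the additive equations
    \<open>r = b2 + c2 + a2\<close> and \<open>r = c3 + a3\<close> obtained below ensure that
    \<open>a2\<close> and \<open>a3\<close> are not truncated.\<close>
  define a1 where "a1 = r - b1 - 1"
  define a2 where "a2 = r - b2 - c2"
  define a3 where "a3 = r - c3"
  have a1: "card (nbrs_at v u 1) = a1"
    if "u \<in> verts G" "v \<in> verts G" "hop_dist G u v = 1" for u v
    using card_neighbours_split[of v u 0] counts(2)[OF that] that
    by (simp add: regular a1_def numeral_2_eq_2)
  have a2: "card (nbrs_at v u 2) = a2" "r = b2 + c2 + a2"
    if "u \<in> verts G" "v \<in> verts G" "hop_dist G u v = 2" for u v
    using card_neighbours_split[of v u 1] card_2[OF that] that
    by (simp_all add: regular a2_def numeral_2_eq_2 numeral_3_eq_3)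
  have a3: "card (nbrs_at v u 3) = a3" "r = c3 + a3"
    if "u \<in> verts G" "v \<in> verts G" "hop_dist G u v = 3" for u v
  proof -
    \<comment> \<open>No vertex is at distance 4, so the outward term in the split of the degree
      vanishes.\<close>
    have "nbrs_at v u 4 = {}" using dist_le[OF _ that(2)] neighbours_subset_verts
      by (force simp: nbrs_at_def)
    then show "card (nbrs_at v u 3) = a3" "r = c3 + a3"
      using card_neighbours_split[of v u 2] card_3[OF that] that
      by (simp_all add: regular a3_def)
  qed

  from hop_dist_diameter(2)[OF diam] obtain u v
    where uv: "u \<in> verts G" "v \<in> verts G" "hop_dist G u v = 3" by blast
  with hop_dist_eq_0_iff have "u \<noteq> v" by fastforce
  \<comment> \<open>Since \<open>c3 > 0\<close>, a pair at distance 2 exists, at which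
    \<open>r = b2 + c2 + a2\<close> can be read off.\<close>
  have "card (nbrs_at v u 2) > 0" using card_3[OF uv] pos by simp
  then obtain w where w: "w \<in> neighbours G u" "hop_dist G w v = 2"
    by (auto simp: card_gt_0_iff nbrs_at_def)
  then have "w \<in> verts G" using neighbours_subset_verts by auto
  with a2(2)[of w v] w uv have r2: "r = b2 + c2 + a2" by simp
  have r3: "r = c3 + a3" using a3(2)[OF uv] .

  from distance_magic_kernel[OF assms(2) regular uv(1,2) \<open>u \<noteq> v\<close>] obtain g x
    where x: "x \<in> verts G" "g x \<noteq> 0"
      and kernel: "\<And>x. x \<in> verts G \<Longrightarrow> (\<Sum>y \<in> neighbours G x. g y) = (0 :: real)"
    by metis
  let ?S = "sphere_sum g x"
  have sum4: "(\<Sum>j\<le>3. h j) = h 0 + h 1 + h 2 + h 3" for h :: "nat \<Rightarrow> real"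
    by (simp add: numeral_2_eq_2 numeral_3_eq_3)
  have S0: "?S 0 = g x" and S1: "?S 1 = 0"
    using x kernel by (simp_all only: sphere_sum_0 sphere_sum_1)
  have cases: "hop_dist G w x = 0 \<or> hop_dist G w x = 1 \<or> hop_dist G w x = 2 \<or> hop_dist G w x = 3"
    if "w \<in> verts G" for w
    using dist_le[OF that x(1)] by linarith
  \<comment> \<open>Entry \<open>j\<close> of the list is the number of neighbours on the sphere of
    radius 1 that a vertex at distance \<open>j\<close> from \<open>x\<close> has. The lists for
    radii 2 and 3 below are read in the same way.\<close>
  have "card (nbrs_at x w 1) = [r, a1, c2, 0] ! hop_dist G w x" if "w \<in> verts G" for w
    using cases[OF that] card_0[OF that x(1)] a1[OF that x(1)] card_2(1)[OF that x(1)] nbrs_at_empty[OF x(1), of 1 w]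
    by (elim disjE) simp_all
  with kernel dist_le[OF _ x(1)] have "(\<Sum>j\<le>3. real ([r, a1, c2, 0] ! j) * ?S j) = 0"
    by (rule sphere_sum_recurrence[where n = "(!) [r, a1, c2, 0]"])
  then have S2: "r * g x + c2 * ?S 2 = 0" by (simp add: sum4 S0 S1[simplified])
  have "card (nbrs_at x w 2) = [0, b1, a2, c3] ! hop_dist G w x" if "w \<in> verts G" for w
    using cases[OF that] card_1[OF that x(1)] a2(1)[OF that x(1)] card_3[OF that x(1)] nbrs_at_empty[OF x(1), of 2 w]
    by (elim disjE) simp_all
  with kernel dist_le[OF _ x(1)] have "(\<Sum>j\<le>3. real ([0, b1, a2, c3] ! j) * ?S j) = 0"
    by (rule sphere_sum_recurrence[where n = "(!) [0, b1, a2, c3]"])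
  then have S3: "a2 * ?S 2 + c3 * ?S 3 = 0" by (simp add: sum4 S1[simplified])
  have "card (nbrs_at x w 3) = [0, 0, b2, a3] ! hop_dist G w x" if "w \<in> verts G" for w
    using cases[OF that] card_2(2)[OF that x(1)] a3(1)[OF that x(1)] nbrs_at_empty[OF x(1), of 3 w]
    by (elim disjE) simp_all
  with kernel dist_le[OF _ x(1)] have "(\<Sum>j\<le>3. real ([0, 0, b2, a3] ! j) * ?S j) = 0"
    by (rule sphere_sum_recurrence[where n = "(!) [0, 0, b2, a3]"])
  then have S4: "b2 * ?S 2 + a3 * ?S 3 = 0" by (simp add: sum4)
  have "?S 2 \<noteq> 0" using S2 x pos by auto
  \<comment> \<open>Eliminating \<open>?S 3\<close>: \<open>a3\<close> times \<open>S3\<close> minus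
    \<open>c3\<close> times \<open>S4\<close>.\<close>
  moreover have "(real a2 * a3 - real b2 * c3) * ?S 2 = 0" using S3 S4 by algebra
  ultimately have "real a2 * a3 = real b2 * c3" by simp
  then have eq: "a2 * a3 = b2 * c3" by (metis of_nat_eq_iff of_nat_mult)
  with pos have "a3 > 0" by (cases "a3 = 0") auto
  \<comment> \<open>The pair \<open>u\<close>, \<open>v\<close> realises the diameter, so
    \<open>a3 > 0\<close> gives an edge from \<open>u\<close> inside the sphere of radius 3 around
    \<open>v\<close>.\<close>
  then have "nbrs_at v u 3 \<noteq> {}" using a3(1)[OF uv] by auto
  then have "primitive G" using not_primitiveD[OF _ diam _ uv] by auto
  moreover have "int r - int b2 - int c2 = int a2" "int r - int c3 = int a3"
    using r2 r3 by simp_all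
  ultimately show ?thesis using eq by (metis of_nat_mult)
qed

end
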